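(* Let $q \geq 2$ and $n \geq 1$. For a real number $t>0$, define the probability measure $Q_{n,t}$ on partitions of $n$ as follows: choose a permutation $\pi$ of $\{1,\dots,n\}$ with probability proportional to $t^{\mathrm{maj}(\pi)+\mathrm{maj}(\pi^{-1})}$, and let $\lambda$ be the transpose of the shape associated to $\pi$ by the Robinson–Schensted–Knuth correspondence; $Q_{n,t}(\lambda)$ is the probability of obtaining $\lambda$. Then for every partition $\lambda$ of $n$, \[ Q_{n,q}(\lambda) = Q_{n,1/q}(\lambda'). \]
   Context: The major index of $\pi \in S_n$ is $\mathrm{maj}(\pi) = \sum_{1 \leq i \leq n-1,\ \pi(i)>\pi(i+1)} i$. $\lambda'$ denotes the transpose (conjugate) partition of $\lambda$. *)

theory Defs
  imports "HOL-Probability.Probability_Mass_Function" "HOL-Combinatorics.Permutations"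
begin

definition partition_of :: "nat \<Rightarrow> nat list \<Rightarrow> bool" where
  "partition_of n lam \<longleftrightarrow> sorted_wrt (\<ge>) lam \<and> 0 \<notin> set lam \<and> sum_list lam = n"

(* For a weakly decreasing list, entry j (counted from 0) of the result is the number of parts
   that exceed j, i.e. the length of column j + 1 of the Young diagram. *)
fun conjugate :: "nat list \<Rightarrow> nat list" where
  "conjugate [] = []"
| "conjugate (k # ks) = map (\<lambda>j. length (filter (\<lambda>m. j < m) (k # ks))) [0..<k]"

definition maj :: "nat \<Rightarrow> (nat \<Rightarrow> nat) \<Rightarrow> nat" where
  "maj n p = (\<Sum>i | 1 \<le> i \<and> i \<le> n - 1 \<and> p i > p (i + 1). i)"

(* Schensted row insertion: x replaces the leftmost larger entry of the row, which is returned as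
   the bumped entry, or is appended to the row (and nothing is bumped) if there is no such entry. *)
fun row_insert :: "nat \<Rightarrow> nat list \<Rightarrow> nat list \<times> nat option" where
  "row_insert x [] = ([x], None)"
| "row_insert x (y # ys) =
     (if x < y then (x # ys, Some y)
      else (case row_insert x ys of (ys', b) \<Rightarrow> (y # ys', b)))"

(* A tableau is the list of its rows, from the longest to the shortest. *)
fun tableau_insert :: "nat \<Rightarrow> nat list list \<Rightarrow> nat list list" where
  "tableau_insert x [] = [[x]]"
| "tableau_insert x (r # rs) =
     (case row_insert x r of
        (r', None) \<Rightarrow> r' # rs
      | (r', Some y) \<Rightarrow> r' # tableau_insert y rs)"

definition insertion_tableau :: "nat \<Rightarrow> (nat \<Rightarrow> nat) \<Rightarrow> nat list list" where
  "insertion_tableau n p = fold tableau_insert (map p [1..<n + 1]) []"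

(* The common shape of the insertion and the recording tableau. *)
definition RSK_shape :: "nat \<Rightarrow> (nat \<Rightarrow> nat) \<Rightarrow> nat list" where
  "RSK_shape n p = map length (insertion_tableau n p)"

definition perm_weight :: "nat \<Rightarrow> real \<Rightarrow> (nat \<Rightarrow> nat) \<Rightarrow> real" where
  "perm_weight n t p = t ^ (maj n p + maj n (inv p))"

definition perm_pmf :: "nat \<Rightarrow> real \<Rightarrow> (nat \<Rightarrow> nat) pmf" where
  "perm_pmf n t = embed_pmf (\<lambda>p. if p permutes {1..n}
     then perm_weight n t p / (\<Sum>s | s permutes {1..n}. perm_weight n t s) else 0)"

definition RSK_measure :: "nat \<Rightarrow> real \<Rightarrow> nat list pmf" where
  "RSK_measure n t = map_pmf (\<lambda>p. conjugate (RSK_shape n p)) (perm_pmf n t)"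

(* The function embedded in perm_pmf is a probability mass function for every t > 0. *)
lemma pmf_perm_pmf:
  assumes "t > 0"
  shows "pmf (perm_pmf n t) p = (if p permutes {1..n}
     then perm_weight n t p / (\<Sum>s | s permutes {1..n}. perm_weight n t s) else 0)"
proof -
  let ?P = "{s. s permutes {1..n}}"
  let ?Z = "\<Sum>s\<in>?P. perm_weight n t s"
  let ?f = "\<lambda>s. if s permutes {1..n} then perm_weight n t s / ?Z else 0"
  have fin: "finite ?P"
    by (simp add: finite_permutations)
  have pos: "perm_weight n t s > 0" for s
    using assms by (simp add: perm_weight_def)
  have "id \<in> ?P"
    by (simp add: permutes_id)
  then have Z: "?Z > 0"
    using fin pos by (intro sum_pos) blast+
  have nonneg: "?f s \<ge> 0" for s
    using pos[of s] Z by simp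
  have "(\<integral>\<^sup>+s. ennreal (?f s) \<partial>count_space UNIV)
      = (\<integral>\<^sup>+s. ennreal (?f s) \<partial>count_space ?P)"
    by (rule nn_integral_count_space_eq) auto
  also have "\<dots> = (\<Sum>s\<in>?P. ennreal (?f s))"
    using fin by (rule nn_integral_count_space_finite)
  also have "\<dots> = ennreal (\<Sum>s\<in>?P. ?f s)"
    by (intro sum_ennreal nonneg)
  also have "(\<Sum>s\<in>?P. ?f s) = (\<Sum>s\<in>?P. perm_weight n t s / ?Z)"
    by (rule sum.cong) auto
  also have "\<dots> = 1"
    using Z by (simp add: sum_divide_distrib[symmetric])
  finally have "(\<integral>\<^sup>+s. ennreal (?f s) \<partial>count_space UNIV) = 1"
    by simp
  then show ?thesis
    unfolding perm_pmf_def using nonneg by (intro pmf_embed_pmf)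
qed

end

theory Submission imports Defs begin

text \<open>
  The Robinson-Schensted correspondence sends a permutation \<open>p\<close> to a pair \<open>(P, Q)\<close> of standard
  tableaux of the same shape, and \<open>maj p\<close> and \<open>maj p\<inverse>\<close> are the major indices of \<open>Q\<close> and \<open>P\<close>: here
  \<open>i\<close> is a descent of a standard tableau if \<open>i + 1\<close> lies in a strictly lower row than \<open>i\<close>.
  The former is the row bumping lemma; the latter holds because an insertion step never changes
  which of \<open>i\<close> and \<open>i + 1\<close> lies strictly lower. In a standard tableau \<open>i + 1\<close> is either strictly
  below or strictly to the right of \<open>i\<close>, but not both, so transposition complements the descent set.
  Transposing both \<open>P\<close> and \<open>Q\<close> therefore gives a bijection of the permutations that transposes
  the shape and replaces \<open>maj p + maj p\<inverse>\<close> by \<open>n (n - 1)\<close> minus it; it carries the weights at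
  \<open>q\<close> to those at \<open>1 / q\<close> up to a common factor.
\<close>

section \<open>Row insertion into tableaux\<close>

definition col_less :: "nat list \<Rightarrow> nat list \<Rightarrow> bool" where
  "col_less r s \<longleftrightarrow> length s \<le> length r \<and> (\<forall>j < length s. r ! j < s ! j)"

definition tab :: "nat list list \<Rightarrow> bool" where
  "tab T \<longleftrightarrow> [] \<notin> set T \<and> (\<forall>r \<in> set T. sorted_wrt (<) r) \<and> sorted_wrt col_less T"

definition first_row :: "nat list list \<Rightarrow> nat list" where
  "first_row T = (case T of [] \<Rightarrow> [] | r # rs \<Rightarrow> r)"

lemma first_row_simps [simp]: "first_row [] = []" "first_row (r # rs) = r"
  by (simp_all add: first_row_def)

lemma transp_col_less: "transp col_less"
  unfolding transp_def col_less_def by (meson le_trans less_le_trans order.strict_trans)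

lemma col_less_Nil [simp]: "col_less r []"
  by (simp add: col_less_def)

lemma tab_Nil [simp]: "tab []"
  by (simp add: tab_def)

text \<open>Since \<open>col_less\<close> is transitive, comparing a row with the next one suffices.
  Every row is \<open>col_less\<close> to \<open>[]\<close>, the default of
  \<open>first_row\<close>, so a single row needs no separate case.\<close>

lemma tab_Cons:
  "tab (r # rs) \<longleftrightarrow> r \<noteq> [] \<and> sorted_wrt (<) r \<and> col_less r (first_row rs) \<and> tab rs"
  by (cases rs) (use sorted_wrt2[OF transp_col_less] in \<open>auto simp: tab_def\<close>)

lemma sorted_first_row: "tab T \<Longrightarrow> sorted_wrt (<) (first_row T)"
  by (cases T) (auto simp: tab_Cons)

lemma set_first_row: "set (first_row T) \<subseteq> set (concat T)"
  by (cases T) auto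

text \<open>All reasoning about one row splits along these two cases: \<open>x\<close> is appended,
  or it takes the place of the bumped \<open>y\<close>.\<close>

lemma row_insert_cases:
  assumes "sorted_wrt (<) r" "x \<notin> set r"
  obtains (append) "row_insert x r = (r @ [x], None)" "\<forall>z \<in> set r. z < x"
  | (bump) a y b where "r = a @ y # b" "\<forall>z \<in> set a. z < x" "x < y"
      "row_insert x r = (a @ x # b, Some y)"
  using assms
proof (induction r arbitrary: thesis)
  case Nil
  then show ?case by simp
next
  case (Cons h t)
  show ?case
  proof (cases "x < h")
    case True
    then show ?thesis using Cons.prems(2)[of "[]" h t] by simp
  next
    case False
    then have "h < x" using Cons.prems by auto
    show ?thesis
    proof (rule Cons.IH)
      assume "row_insert x t = (t @ [x], None)" "\<forall>z \<in> set t. z < x"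
      then show thesis using Cons.prems(1) \<open>h < x\<close> by auto
    next
      fix a y b
      assume "t = a @ y # b" "\<forall>z \<in> set a. z < x" "x < y" "row_insert x t = (a @ x # b, Some y)"
      then show thesis using Cons.prems(2)[of "h # a" y b] \<open>h < x\<close> by auto
    qed (use Cons.prems in auto)
  qed
qed

lemma nth_replace:
  "(a @ x # b) ! j = (if j = length a then x else (a @ y # b) ! j)"
  by (auto simp: nth_append nth_Cons split: nat.splits)

lemma row_insert_bump:
  assumes "\<forall>z \<in> set a. z < x" "x < y"
  shows "row_insert x (a @ y # b) = (a @ x # b, Some y)"
  using assms by (induction a) auto

lemma row_insert_append:
  assumes "\<forall>z \<in> set a. z < x"
  shows "row_insert x a = (a @ [x], None)"
  using assms by (induction a) auto

lemma sorted_row_insert: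
  assumes "sorted_wrt (<) r" "x \<notin> set r"
  shows "sorted_wrt (<) (fst (row_insert x r))"
  by (rule row_insert_cases[OF assms])
    (use assms(1) in \<open>auto simp: sorted_wrt_append intro: less_trans\<close>)

text \<open>The bumped \<open>y\<close> lands weakly left of the column it leaves, because the entry
  formerly under it is larger or absent. In those columns the new upper row is smaller than
  \<open>y\<close>; elsewhere upper entries can only decrease.\<close>

lemma col_less_bump:
  assumes s: "sorted_wrt (<) s" and "y \<notin> set s"
    and a: "\<forall>z \<in> set a. z < x" and "x < y" and less: "col_less (a @ y # b) s"
  shows "col_less (a @ x # b) (fst (row_insert y s))"
proof -
  have rep: "(a @ x # b) ! j \<le> (a @ y # b) ! j" for j
    using \<open>x < y\<close> nth_replace[of a x b j y] by auto
  have le: "(a @ x # b) ! j < y" if "j \<le> length a" for j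
    using that a \<open>x < y\<close> by (cases "j = length a") (auto simp: nth_append intro: less_trans[OF _ \<open>x < y\<close>])
  have len: "length s \<le> Suc (length a + length b)" and
    nth: "\<And>j. j < length s \<Longrightarrow> (a @ y # b) ! j < s ! j"
    using less by (auto simp: col_less_def)
  show ?thesis
  proof (rule row_insert_cases[OF s \<open>y \<notin> set s\<close>])
    assume ins: "row_insert y s = (s @ [y], None)" "\<forall>z \<in> set s. z < y"
    \<comment> \<open>An entry of \<open>s\<close> in column \<open>length a\<close> would have to
      exceed \<open>y\<close>, which stood above it.\<close>
    have "length s \<le> length a"
      using nth[of "length a"] ins(2) by (metis less_asym not_le nth_append_length nth_mem)
    then show ?thesis
      unfolding col_less_def using ins(1) le rep nth
      by (auto simp: nth_append[of s] less_Suc_eq intro: le_less_trans)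
  next
    fix c z d
    assume ins: "s = c @ z # d" "\<forall>v \<in> set c. v < y" "y < z" "row_insert y s = (c @ y # d, Some z)"
    have "length c \<le> length a"
    proof (rule ccontr)
      assume "\<not> length c \<le> length a"
      then show False using nth[of "length a"] ins(1,2)
        by (auto simp: nth_append) (metis less_asym not_le nth_mem)
    qed
    then have "(a @ x # b) ! j < (c @ y # d) ! j" if "j < length s" for j
      using le[of j] rep[of j] nth[OF that] nth_replace[of c y d j z] ins(1)
      by (auto split: if_splits)
    then show ?thesis
      unfolding col_less_def using ins len by auto
  qed
qed

text \<open>Reverse of \<open>col_less_bump\<close>: the entry above \<open>y\<close> is smaller
  than \<open>y\<close> while all of \<open>b\<close> is larger, so \<open>y\<close> sits weakly
  left of column \<open>length a\<close> and may return to that column.\<close>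

lemma col_less_unbump:
  assumes s: "sorted_wrt (<) s" and "y \<notin> set s"
    and b: "\<forall>z \<in> set b. y < z" and "x < y" and less: "col_less (a @ x # b) (fst (row_insert y s))"
  shows "col_less (a @ y # b) s"
proof -
  have ge: "j \<le> length a" if "(a @ x # b) ! j < y" "j < Suc (length a + length b)" for j
  proof (rule ccontr)
    assume "\<not> j \<le> length a"
    then have "(a @ x # b) ! j \<in> set b"
      using that(2) by (auto simp: nth_append nth_Cons split: nat.splits)
    then show False using b that(1) by auto
  qed
  show ?thesis
  proof (rule row_insert_cases[OF s \<open>y \<notin> set s\<close>])
    assume ins: "row_insert y s = (s @ [y], None)" "\<forall>z \<in> set s. z < y"
    then have "length s \<le> length a"
      using less ge[of "length s"] unfolding col_less_def by auto
    moreover have "(a @ x # b) ! j < s ! j" if "j < length s" for j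
      using less ins that unfolding col_less_def by (auto simp: nth_append[of s] less_Suc_eq)
    ultimately show ?thesis
      unfolding col_less_def using nth_replace[of a y b _ x] by auto
  next
    fix c z d
    assume ins: "s = c @ z # d" "\<forall>v \<in> set c. v < y" "y < z" "row_insert y s = (c @ y # d, Some z)"
    have nth: "(a @ x # b) ! j < (c @ y # d) ! j" if "j < length s" for j
      using that less ins unfolding col_less_def by auto
    have len: "length s \<le> Suc (length a + length b)"
      using less ins unfolding col_less_def by auto
    have ca: "length c \<le> length a"
      using nth[of "length c"] ins(1) len ge[of "length c"] by auto
    have "(a @ y # b) ! j < s ! j" if j: "j < length s" for j
    proof (cases "j = length a")
      case True
      \<comment> \<open>\<open>z\<close> stands in column \<open>length c\<close>, weakly left of
        \<open>j\<close>, and \<open>s\<close> increases; so the entry under the returning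
        \<open>y\<close> exceeds \<open>y\<close>.\<close>
      have "z \<le> s ! j"
      proof (cases "j = length c")
        case False
        then have "s ! length c < s ! j"
          using s j True ca by (auto simp: sorted_wrt_iff_nth_less)
        then show ?thesis by (simp add: ins(1))
      qed (simp add: ins(1))
      then show ?thesis using True \<open>y < z\<close> by simp
    next
      case False
      then show ?thesis
        using nth[OF j] nth_replace[of a y b j x] nth_replace[of c z d j y] ins(1,3)
        by (auto split: if_splits)
    qed
    then show ?thesis using len by (auto simp: col_less_def)
  qed
qed

lemma first_row_insert:
  "first_row (tableau_insert x T) = fst (row_insert x (first_row T))"
  by (cases T) (auto split: prod.splits option.splits)

text \<open>Induction down the rows: the bumped entry is inserted into the remaining tableau, and
  \<open>col_less_bump\<close> keeps the two adjacent rows compatible.\<close>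

lemma tab_insert:
  assumes "tab T" "x \<notin> set (concat T)" "distinct (concat T)"
  shows "tab (tableau_insert x T) \<and> distinct (concat (tableau_insert x T))
    \<and> set (concat (tableau_insert x T)) = insert x (set (concat T))"
  using assms
proof (induction T arbitrary: x)
  case Nil
  then show ?case by (simp add: tab_Cons)
next
  case (Cons r rs)
  have r: "r \<noteq> []" "sorted_wrt (<) r" "col_less r (first_row rs)" "tab rs" "x \<notin> set r"
    using Cons.prems by (auto simp: tab_Cons)
  show ?case
  proof (rule row_insert_cases[OF r(2,5)])
    assume ins: "row_insert x r = (r @ [x], None)" "\<forall>z \<in> set r. z < x"
    have "col_less (r @ [x]) (first_row rs)"
      using r(3) by (auto simp: col_less_def nth_append)
    then show ?thesis
      using Cons.prems ins r by (auto simp: tab_Cons sorted_wrt_append)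
  next
    fix a y b
    assume ins: "r = a @ y # b" "\<forall>z \<in> set a. z < x" "x < y" "row_insert x r = (a @ x # b, Some y)"
    have IH: "tab (tableau_insert y rs)" "distinct (concat (tableau_insert y rs))"
      "set (concat (tableau_insert y rs)) = insert y (set (concat rs))"
      using Cons.IH[of y] r Cons.prems ins(1) by auto
    have "col_less (a @ x # b) (first_row (tableau_insert y rs))"
      unfolding first_row_insert
      using r Cons.prems(3) ins set_first_row[of rs]
      by (intro col_less_bump[where y = y]) (auto intro: sorted_first_row)
    moreover have "sorted_wrt (<) (a @ x # b)"
      using sorted_row_insert[OF r(2,5)] ins by simp
    moreover from this have "distinct (a @ x # b)" by (simp add: strict_sorted_iff)
    ultimately show ?thesis
      using IH Cons.prems ins by (auto simp: tab_Cons)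
  qed
qed

section \<open>Shapes under insertion and recording\<close>

fun insert_row :: "nat \<Rightarrow> nat list list \<Rightarrow> nat" where
  "insert_row x [] = 0"
| "insert_row x (r # rs) =
     (case row_insert x r of (_, None) \<Rightarrow> 0 | (_, Some y) \<Rightarrow> Suc (insert_row y rs))"

text \<open>Equality means that the bumping runs past the last row and opens a new one.\<close>

lemma insert_row_le: "insert_row x T \<le> length T"
  by (induction x T rule: insert_row.induct) (auto split: prod.splits option.splits)

fun add_cell :: "nat \<Rightarrow> nat list \<Rightarrow> nat list" where
  "add_cell k [] = [1]"
| "add_cell 0 (l # ls) = Suc l # ls"
| "add_cell (Suc k) (l # ls) = l # add_cell k ls"

fun add_entry :: "nat \<Rightarrow> nat \<Rightarrow> nat list list \<Rightarrow> nat list list" where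
  "add_entry m k [] = [[m]]"
| "add_entry m 0 (r # rs) = (r @ [m]) # rs"
| "add_entry m (Suc k) (r # rs) = r # add_entry m k rs"

lemma length_row_insert:
  "length (fst (row_insert x r)) = (if snd (row_insert x r) = None then Suc (length r) else length r)"
  by (induction r) (auto split: prod.splits)

lemma shape_insert:
  "map length (tableau_insert x T) = add_cell (insert_row x T) (map length T)"
proof (induction T arbitrary: x)
  case (Cons r rs)
  then show ?case
    using length_row_insert[of x r] by (auto split: prod.splits option.splits)
qed simp

lemma shape_add_entry: "map length (add_entry m k Q) = add_cell k (map length Q)"
  by (induction m k Q rule: add_entry.induct) auto

text \<open>Excluding zero parts matters: for \<open>k = 0\<close>, both \<open>[]\<close> and
  \<open>[0]\<close> grow to \<open>[1]\<close>.\<close>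

lemma add_cell_inj:
  assumes "add_cell k s = add_cell k s'" "0 \<notin> set s" "0 \<notin> set s'" "k \<le> length s" "k \<le> length s'"
  shows "s = s'"
  using assms
proof (induction k s arbitrary: s' rule: add_cell.induct)
  case (1 k)
  then show ?case by (cases s') auto
next
  case (2 l ls)
  then show ?case by (cases s') auto
next
  case (3 k l ls)
  then show ?case by (cases s') auto
qed

text \<open>Used to undo a bump: \<open>x\<close> is the greatest entry smaller than
  \<open>y\<close>, so the entries up to \<open>y\<close> are exactly
  \<open>a @ [x]\<close>.\<close>

lemma split_unique:
  fixes y :: nat
  assumes "a @ x # b = a' @ x' # b'" "\<forall>z \<in> set a. z < x" "x < y" "\<forall>z \<in> set b. y < z"
    "\<forall>z \<in> set a'. z < x'" "x' < y" "\<forall>z \<in> set b'. y < z"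
  shows "a = a' \<and> x = x' \<and> b = b'"
proof -
  have "filter (\<lambda>z. z \<le> y) (a @ x # b) = a @ [x]"
    if "\<forall>z \<in> set a. z < x" "x < y" "\<forall>z \<in> set b. y < z" for a x b
  proof -
    have "\<forall>z \<in> set a. z \<le> y" using that by (meson less_imp_le less_trans)
    moreover have "\<forall>z \<in> set b. \<not> z \<le> y" using that(3) by auto
    ultimately show ?thesis using that(2) by (simp add: filter_id_conv filter_empty_conv)
  qed
  from this[OF assms(2-4)] this[OF assms(5-7)] have "a @ [x] = a' @ [x']"
    using assms(1) by simp
  then show ?thesis using assms(1) by simp
qed

text \<open>The row of the new cell tells where reverse bumping starts. In the first row, the
  inserted entry is the last one; otherwise the lower rows determine the bumped entry by induction,
  and \<open>split_unique\<close> locates the entry that displaced it.\<close>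

lemma tableau_insert_inj:
  assumes "tab T" "tab S" "x \<notin> set (concat T)" "y \<notin> set (concat S)"
    "distinct (concat T)" "distinct (concat S)"
    "tableau_insert x T = tableau_insert y S" "insert_row x T = insert_row y S"
  shows "x = y \<and> T = S"
  using assms
proof (induction T arbitrary: x y S)
  case Nil
  show ?case
  proof (cases S)
    case (Cons s ss)
    have s: "sorted_wrt (<) s" "y \<notin> set s" "s \<noteq> []"
      using Nil Cons by (auto simp: tab_Cons)
    show ?thesis
      by (rule row_insert_cases[OF s(1,2)]) (use Nil Cons s in auto)
  qed (use Nil in auto)
next
  case (Cons r rs)
  have r: "sorted_wrt (<) r" "x \<notin> set r" "r \<noteq> []"
    using Cons.prems by (auto simp: tab_Cons)
  show ?case
  proof (cases S)
    case Nil
    show ?thesis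
      by (rule row_insert_cases[OF r(1,2)]) (use Nil Cons.prems r in auto)
  next
    case S: (Cons s ss)
    have s: "sorted_wrt (<) s" "y \<notin> set s" "s \<noteq> []"
      using Cons.prems S by (auto simp: tab_Cons)
    show ?thesis
    proof (rule row_insert_cases[OF r(1,2)])
      assume 1: "row_insert x r = (r @ [x], None)"
      show ?thesis
        by (rule row_insert_cases[OF s(1,2)]) (use 1 S Cons.prems in auto)
    next
      fix a z b
      assume 1: "r = a @ z # b" "\<forall>v\<in>set a. v < x" "x < z" "row_insert x r = (a @ x # b, Some z)"
      show ?thesis
      proof (rule row_insert_cases[OF s(1,2)])
        assume "row_insert y s = (s @ [y], None)"
        then show ?thesis using 1 S Cons.prems by auto
      next
        fix a' z' b'
        assume 2: "s = a' @ z' # b'" "\<forall>v\<in>set a'. v < y" "y < z'"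
          "row_insert y s = (a' @ y # b', Some z')"
        have IH: "z = z' \<and> rs = ss"
          by (rule Cons.IH) (use 1 2 S Cons.prems in \<open>auto simp: tab_Cons\<close>)
        have "a = a' \<and> x = y \<and> b = b'"
          by (rule split_unique[where y = z])
            (use 1 2 S Cons.prems r(1) s(1) IH in \<open>auto simp: sorted_wrt_append\<close>)
        then show ?thesis using IH 1 2 S by auto
      qed
    qed
  qed
qed

lemma split_greatest_less:
  assumes "sorted_wrt (<) r" "v \<in> set r" "v < (y :: nat)" "y \<notin> set r"
  obtains a x b where "r = a @ x # b" "\<forall>z\<in>set a. z < x" "x < y" "\<forall>z\<in>set b. y < z"
proof -
  have "\<exists>x\<in>set r. x < y" using assms(2,3) by auto
  then obtain a x b where s: "r = a @ x # b" "x < y" "\<forall>z\<in>set b. \<not> z < y"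
    using split_list_last_prop[of r "\<lambda>x. x < y"] by blast
  show ?thesis
  proof (rule that[OF s(1) _ s(2)])
    show "\<forall>z\<in>set a. z < x" using assms(1) s(1) by (auto simp: sorted_wrt_append)
    show "\<forall>z\<in>set b. y < z" using s assms(4) by (auto simp: not_less le_less)
  qed
qed

text \<open>For a tableau: the last cell of row \<open>k\<close>, counted from 0, can be removed so
  that a partition shape remains.\<close>

definition corner :: "nat \<Rightarrow> nat list list \<Rightarrow> bool" where
  "corner k T \<longleftrightarrow> k < length T \<and> (Suc k < length T \<longrightarrow> length (T ! Suc k) < length (T ! k))"

text \<open>Reverse bumping, by induction on the row of the removed cell. Undoing the lower rows
  yields an entry \<open>y\<close>, which takes the place of the greatest smaller entry of the row
  above; that entry is expelled in turn.\<close>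

lemma tableau_insert_surj:
  assumes "tab T'" "distinct (concat T')" "corner k T'"
  shows "\<exists>x T. tab T \<and> distinct (concat T) \<and> x \<notin> set (concat T)
    \<and> tableau_insert x T = T' \<and> insert_row x T = k"
  using assms
proof (induction k arbitrary: T')
  case 0
  then obtain r rs where T': "T' = r # rs" by (cases T') (auto simp: corner_def)
  then have r: "r \<noteq> []" "sorted_wrt (<) r" "col_less r (first_row rs)" "tab rs" "distinct r"
    using 0 by (auto simp: tab_Cons)
  have rb: "r = butlast r @ [last r]" using r by simp
  have len: "length (first_row rs) < length r"
    using 0(3) T' r(1) by (cases rs) (auto simp: corner_def)
  have lt: "\<forall>z\<in>set (butlast r). z < last r"
    using r(2) rb by (metis (no_types, lifting) list.set_intros(1) sorted_wrt_append)
  show ?case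
  proof (cases "butlast r = []")
    case True
    \<comment> \<open>The row would become empty, which \<open>tab\<close> forbids. Being a corner,
      it has no row below, so the witness is the empty tableau.\<close>
    then have "rs = []" using len r(4) rb by (cases rs) (auto simp: tab_Cons dest: arg_cong[of r _ length])
    then show ?thesis using T' True rb
      by (intro exI[of _ "last r"] exI[of _ "[]"]) auto
  next
    case False
    have "col_less (butlast r) (first_row rs)"
      using r(3) len by (auto simp: col_less_def nth_butlast)
    moreover have "sorted_wrt (<) (butlast r)"
      using r(2) rb by (metis sorted_wrt_append)
    moreover have "distinct (concat (butlast r # rs))" "last r \<notin> set (concat (butlast r # rs))"
      using 0(2) T' r(1) rb lt by (auto dest: in_set_butlastD last_in_set simp: distinct_butlast)
    ultimately show ?thesis
      using T' r False row_insert_append[OF lt]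
      by (intro exI[of _ "last r"] exI[of _ "butlast r # rs"]) (auto simp: tab_Cons)
  qed
next
  case (Suc k)
  then obtain r rs where T': "T' = r # rs" by (cases T') (auto simp: corner_def)
  then have r: "r \<noteq> []" "sorted_wrt (<) r" "col_less r (first_row rs)" "tab rs" "distinct r"
    using Suc by (auto simp: tab_Cons)
  have "corner k rs" using Suc.prems T' by (auto simp: corner_def)
  then obtain y S where S: "tab S" "distinct (concat S)" "y \<notin> set (concat S)"
    "tableau_insert y S = rs" "insert_row y S = k"
    using Suc.IH[of rs] Suc.prems T' r by auto
  have yS: "y \<notin> set (first_row S)" using S(3) set_first_row by blast
  have fr: "first_row rs = fst (row_insert y (first_row S))"
    using first_row_insert S(4) by metis
  have set_rs: "set (concat rs) = insert y (set (concat S))"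
    using tab_insert[OF S(1,3,2)] S(4) by auto
  then have yr: "y \<notin> set r" using Suc.prems(2) T' by auto
  \<comment> \<open>Since \<open>y\<close> is in the top row of \<open>rs\<close>, the entry of
    \<open>r\<close> above it is smaller: reverse bumping always finds an entry to expel.\<close>
  have "y \<in> set (first_row rs)"
    unfolding fr by (rule row_insert_cases[OF sorted_first_row[OF S(1)] yS]) auto
  then obtain j where "j < length (first_row rs)" "first_row rs ! j = y"
    by (auto simp: in_set_conv_nth)
  then have "r ! j \<in> set r" "r ! j < y" using r(3) by (auto simp: col_less_def)
  then obtain a x b where s: "r = a @ x # b" "\<forall>z\<in>set a. z < x" "x < y" "\<forall>z\<in>set b. y < z"
    using split_greatest_less[OF r(2)] yr by metis
  have "col_less (a @ y # b) (first_row S)"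
    using sorted_first_row[OF S(1)] yS s(4,3) r(3) unfolding fr s(1) by (rule col_less_unbump)
  moreover have "sorted_wrt (<) (a @ y # b)"
    using r(2) s by (auto simp: sorted_wrt_append intro: less_trans)
  moreover have "distinct (concat ((a @ y # b) # S))" "x \<notin> set (concat ((a @ y # b) # S))"
    using Suc.prems(2) T' s set_rs S(2,3) yr by auto
  ultimately show ?case
    using S T' s row_insert_bump[OF s(2,3)]
    by (intro exI[of _ x] exI[of _ "(a @ y # b) # S"]) (auto simp: tab_Cons)
qed

section \<open>Descents and the correspondence on words\<close>

text \<open>The row index is only meaningful if \<open>v\<close> occurs; otherwise it is the number of rows.\<close>

fun row_of :: "nat \<Rightarrow> nat list list \<Rightarrow> nat" where
  "row_of v [] = 0"
| "row_of v (r # rs) = (if v \<in> set r then 0 else Suc (row_of v rs))"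

definition standard :: "nat set \<Rightarrow> nat list list \<Rightarrow> bool" where
  "standard A T \<longleftrightarrow> tab T \<and> distinct (concat T) \<and> set (concat T) = A"

lemma standard_insert:
  "standard A T \<Longrightarrow> x \<notin> A \<Longrightarrow> standard (insert x A) (tableau_insert x T)"
  using tab_insert unfolding standard_def by blast

text \<open>Row bumping lemma. If \<open>x' < x\<close>, the second insertion bumps an entry
  \<open>y'\<close> that is at most \<open>x\<close>, hence smaller than \<open>y\<close>; if
  \<open>x < x'\<close>, any entry it bumps comes from \<open>b\<close> and exceeds
  \<open>y\<close>. So the bumped entries inherit the comparison.\<close>

lemma insert_row_less_iff:
  assumes "tab T" "distinct (concat T)" "x \<notin> set (concat T)" "x' \<notin> set (concat T)" "x \<noteq> x'"
  shows "insert_row x T < insert_row x' (tableau_insert x T) \<longleftrightarrow> x' < x"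
  using assms
proof (induction T arbitrary: x x')
  case Nil
  then show ?case by auto
next
  case (Cons r rs)
  have r: "sorted_wrt (<) r" "x \<notin> set r" "x' \<notin> set r" "tab rs" "distinct r"
    using Cons.prems by (auto simp: tab_Cons)
  have sorted': "sorted_wrt (<) (fst (row_insert x r))"
    using sorted_row_insert[OF r(1,2)] .
  show ?case
  proof (rule row_insert_cases[OF r(1,2)])
    assume 1: "row_insert x r = (r @ [x], None)" "\<forall>z\<in>set r. z < x"
    have s: "sorted_wrt (<) (r @ [x])" "x' \<notin> set (r @ [x])"
      using sorted' r 1 Cons.prems(5) by auto
    show ?thesis
    proof (rule row_insert_cases[OF s])
      assume "row_insert x' (r @ [x]) = ((r @ [x]) @ [x'], None)" "\<forall>z\<in>set (r @ [x]). z < x'"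
      then show ?thesis using 1 by auto
    next
      fix a y b
      assume 2: "r @ [x] = a @ y # b" "x' < y" "row_insert x' (r @ [x]) = (a @ x' # b, Some y)"
      have "y \<in> set (r @ [x])" using 2(1) by simp
      then have "x' < x" using 1(2) 2(2) by auto
      then show ?thesis using 1 2 by auto
    qed
  next
    fix a y b
    assume 1: "r = a @ y # b" "\<forall>z\<in>set a. z < x" "x < y" "row_insert x r = (a @ x # b, Some y)"
    have s: "sorted_wrt (<) (a @ x # b)" "x' \<notin> set (a @ x # b)"
      using sorted' r 1 Cons.prems(5) by auto
    have b: "\<forall>z\<in>set b. y < z" using r(1) 1(1) by (auto simp: sorted_wrt_append)
    show ?thesis
    proof (rule row_insert_cases[OF s])
      assume "row_insert x' (a @ x # b) = ((a @ x # b) @ [x'], None)" "\<forall>z\<in>set (a @ x # b). z < x'"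
      then show ?thesis using 1 by auto
    next
      fix a' y' b'
      assume 2: "a @ x # b = a' @ y' # b'" "\<forall>z\<in>set a'. z < x'" "x' < y'"
        "row_insert x' (a @ x # b) = (a' @ x' # b', Some y')"
      have y': "y' \<in> set (a @ x # b)" using 2(1) by simp
      have "y \<noteq> y'" using y' 1 r(5) by auto
      have "y' \<notin> set (concat rs)" using y' 1 Cons.prems(2,3) by auto
      then have IH: "insert_row y rs < insert_row y' (tableau_insert y rs) \<longleftrightarrow> y' < y"
        using Cons.prems(2) 1(1) r(4) \<open>y \<noteq> y'\<close> by (intro Cons.IH) auto
      have "y' < y" if "x' < x"
      proof -
        have "x \<in> set (a' @ y' # b')" using 2(1) by (metis in_set_conv_decomp)
        then have "y' \<le> x"
          using that 2(2) s(1) unfolding 2(1) by (auto simp: sorted_wrt_append)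
        then show ?thesis using 1(3) by simp
      qed
      moreover have "y < y'" if "x < x'"
        using y' 1(2) b that 2(3) by auto
      ultimately have "y' < y \<longleftrightarrow> x' < x"
        using Cons.prems(5) by (metis less_asym nat_neq_iff)
      then show ?thesis using 1 2 IH by auto
    qed
  qed
qed

lemma row_of_inserted: "row_of x (tableau_insert x T) = 0"
proof (cases T)
  case (Cons r rs)
  have "x \<in> set (fst (row_insert x r))" by (induction r) (auto split: prod.splits)
  then show ?thesis using Cons by (auto split: prod.splits option.splits)
qed simp

text \<open>If \<open>Suc x\<close> is in the first row, it is the least entry exceeding
  \<open>x\<close> and therefore the one bumped.\<close>

lemma row_of_Suc_inserted:
  assumes "tab T" "distinct (concat T)" "x \<notin> set (concat T)" "Suc x \<in> set (concat T)"
  shows "row_of (Suc x) (tableau_insert x T) > 0"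
proof (cases T)
  case (Cons r rs)
  have r: "sorted_wrt (<) r" "x \<notin> set r" "distinct r"
    using assms Cons by (auto simp: tab_Cons)
  show ?thesis
  proof (rule row_insert_cases[OF r(1,2)])
    assume "row_insert x r = (r @ [x], None)" "\<forall>z\<in>set r. z < x"
    then show ?thesis using assms Cons by auto
  next
    fix a y b
    assume 1: "r = a @ y # b" "\<forall>z\<in>set a. z < x" "x < y" "row_insert x r = (a @ x # b, Some y)"
    have "Suc x \<notin> set (a @ x # b)"
      using 1 r(1) by (auto simp: sorted_wrt_append)
    then show ?thesis using 1 Cons by auto
  qed
qed (use assms in auto)

text \<open>In each row, only a bump of \<open>v\<close> or of \<open>Suc v\<close> could affect the
  comparison; both cases are checked by hand, and any other bump is left to the induction.\<close>

lemma row_of_less_insert: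
  assumes "tab T" "distinct (concat T)" "x \<notin> set (concat T)"
    "v \<in> set (concat T)" "Suc v \<in> set (concat T)"
  shows "row_of v (tableau_insert x T) < row_of (Suc v) (tableau_insert x T)
    \<longleftrightarrow> row_of v T < row_of (Suc v) T"
  using assms
proof (induction T arbitrary: x)
  case (Cons r rs)
  have r: "sorted_wrt (<) r" "x \<notin> set r" "distinct r" "tab rs" "distinct (concat rs)"
    using Cons.prems by (auto simp: tab_Cons)
  have vx: "v \<noteq> x" "Suc v \<noteq> x" using Cons.prems by auto
  show ?case
  proof (rule row_insert_cases[OF r(1,2)])
    assume "row_insert x r = (r @ [x], None)"
    then show ?thesis using vx by auto
  next
    fix a y b
    assume 1: "r = a @ y # b" "\<forall>z\<in>set a. z < x" "x < y" "row_insert x r = (a @ x # b, Some y)"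
    have y: "y \<notin> set (concat rs)" "y \<notin> set (a @ x # b)" using Cons.prems(2) 1 by auto
    consider "y = v" | "y = Suc v" | "y \<noteq> v" "y \<noteq> Suc v" by blast
    then show ?thesis
    proof cases
      case yv: 1
      show ?thesis
      \<comment> \<open>If \<open>Suc v\<close> shares the row with \<open>v\<close>, it stays
        behind, and the comparison is false before and after. Otherwise \<open>v\<close> enters the
        first row of \<open>rs\<close> and \<open>Suc v\<close> is strictly lower by
        \<open>row_of_Suc_inserted\<close>.\<close>
      proof (cases "Suc v \<in> set r")
        case True
        then show ?thesis using 1 yv by auto
      next
        case False
        then have "Suc v \<in> set (concat rs)" using Cons.prems by auto
        then show ?thesis
          using row_of_inserted[of v rs] row_of_Suc_inserted[of rs v] r(4,5) y 1 yv False vx by auto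
      qed
    next
      case yv: 2
      \<comment> \<open>Here \<open>x < v\<close>, so a \<open>v\<close> in this row would have kept
        \<open>Suc v\<close> from being bumped. Thus \<open>v\<close> lies in \<open>rs\<close>, and
        \<open>Suc v\<close> moves only to the first row of \<open>rs\<close>, no lower than
        \<open>v\<close>.\<close>
      have "v \<notin> set r"
        using 1 yv vx r(1) by (auto simp: sorted_wrt_append)
      then show ?thesis using row_of_inserted[of "Suc v" rs] 1 yv vx y by auto
    next
      case 3
      have "row_of v (tableau_insert y rs) < row_of (Suc v) (tableau_insert y rs)
        \<longleftrightarrow> row_of v rs < row_of (Suc v) rs" if "v \<notin> set r" "Suc v \<notin> set r"
        using that Cons.prems y r by (intro Cons.IH) auto
      then show ?thesis using 3 1 vx by auto
    qed
  qed
qed simp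

text \<open>
  The list \<open>u\<close> is the word read from right to left, so that inserting the next letter is a \<open>Cons\<close>.
\<close>

abbreviation P_tableau :: "nat list \<Rightarrow> nat list list" where
  "P_tableau u \<equiv> foldr tableau_insert u []"

fun Q_tableau :: "nat list \<Rightarrow> nat list list" where
  "Q_tableau [] = []"
| "Q_tableau (x # u) = add_entry (Suc (length u)) (insert_row x (P_tableau u)) (Q_tableau u)"

lemma standard_P_tableau: "distinct u \<Longrightarrow> standard (set u) (P_tableau u)"
  by (induction u) (auto intro: standard_insert, simp add: standard_def)

text \<open>\<open>a < b\<close> says that \<open>v\<close> is inserted after \<open>Suc v\<close>.
  The later of the two lands in the first row, which settles the comparison (by
  \<open>row_of_Suc_inserted\<close> if it is \<open>v\<close>); further insertions keep it by
  \<open>row_of_less_insert\<close>.\<close>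

lemma row_of_P_tableau:
  assumes "distinct u" "a < length u" "b < length u" "u ! a = v" "u ! b = Suc v"
  shows "row_of v (P_tableau u) < row_of (Suc v) (P_tableau u) \<longleftrightarrow> a < b"
  using assms
proof (induction u arbitrary: a b)
  case (Cons x u)
  have T: "tab (P_tableau u)" "distinct (concat (P_tableau u))" "set (concat (P_tableau u)) = set u"
    using standard_P_tableau[of u] Cons.prems(1) by (auto simp: standard_def)
  show ?case
  proof (cases a)
    case 0
    then obtain b' where b: "b = Suc b'" using Cons.prems by (cases b) auto
    then have "Suc v \<in> set u" using Cons.prems nth_mem[of b' u] by simp
    then have "row_of (Suc v) (tableau_insert v (P_tableau u)) > 0"
      using 0 Cons.prems T by (intro row_of_Suc_inserted) auto
    then show ?thesis using 0 b Cons.prems row_of_inserted by auto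
  next
    case a: (Suc a')
    show ?thesis
    proof (cases b)
      case 0
      then show ?thesis using Cons.prems row_of_inserted by auto
    next
      case (Suc b')
      then have "v \<in> set u" "Suc v \<in> set u"
        using a Cons.prems nth_mem[of a' u] nth_mem[of b' u] by simp_all
      moreover have "x \<notin> set u" using Cons.prems by simp
      ultimately show ?thesis
        using row_of_less_insert[OF T(1,2), of x v, unfolded T(3)] Cons a Suc by simp
    qed
  qed
qed simp

section \<open>Adding and removing the greatest entry\<close>

lemma set_add_entry: "set (concat (add_entry m k Q)) = insert m (set (concat Q))"
  by (induction m k Q rule: add_entry.induct) auto

lemma distinct_add_entry:
  "m \<notin> set (concat Q) \<Longrightarrow> distinct (concat (add_entry m k Q)) \<longleftrightarrow> distinct (concat Q)"
proof (induction m k Q rule: add_entry.induct)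
  case (3 m k r rs)
  then show ?case using set_add_entry[of m k rs] by auto
qed auto

lemma row_of_add_entry:
  "v \<in> set (concat Q) \<Longrightarrow> v \<noteq> m \<Longrightarrow> row_of v (add_entry m k Q) = row_of v Q"
  by (induction m k Q rule: add_entry.induct) auto

lemma row_of_added:
  "m \<notin> set (concat Q) \<Longrightarrow> k \<le> length Q \<Longrightarrow> row_of m (add_entry m k Q) = k"
  by (induction m k Q rule: add_entry.induct) auto

text \<open>Empty rows are excluded because \<open>[]\<close> and \<open>[[]]\<close> both become
  \<open>[[m]]\<close> for \<open>k = 0\<close>.\<close>

lemma add_entry_inj:
  assumes "add_entry m k Q = add_entry m k Q'" "[] \<notin> set Q" "[] \<notin> set Q'"
    "k \<le> length Q" "k \<le> length Q'"
  shows "Q = Q'"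
  using assms
proof (induction m k Q arbitrary: Q' rule: add_entry.induct)
  case (1 m k)
  then show ?case by (cases Q') auto
next
  case (2 m r rs)
  then show ?case by (cases Q') auto
next
  case (3 m k r rs)
  then show ?case by (cases Q') auto
qed

lemma first_row_add_entry:
  "first_row (add_entry m k Q) = (if k = 0 \<or> Q = [] then first_row Q @ [m] else first_row Q)"
  by (cases "(m, k, Q)" rule: add_entry.cases) auto

text \<open>\<open>T\<close> lends its shape, which keeps the extended row no longer than the row
  above. The order conditions hold because \<open>m\<close> exceeds all entries.\<close>

lemma tab_add_entry:
  assumes "tab Q" "\<forall>v \<in> set (concat Q). v < m" "tab T"
    "map length (add_entry m k Q) = map length T"
  shows "tab (add_entry m k Q)"
  using assms
proof (induction m k Q arbitrary: T rule: add_entry.induct)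
  case (1 m k)
  then show ?case by (simp add: tab_Cons)
next
  case (2 m r rs)
  then have "col_less (r @ [m]) (first_row rs)"
    by (auto simp: tab_Cons col_less_def nth_append)
  then show ?case using 2 by (auto simp: tab_Cons sorted_wrt_append)
next
  case (3 m k r rs)
  then obtain s ss where T: "T = s # ss" "length s = length r"
    "map length (add_entry m k rs) = map length ss" by auto
  then have "length (first_row (add_entry m k rs)) = length (first_row ss)"
    by (cases ss; cases "add_entry m k rs") auto
  also have "\<dots> \<le> length r" using 3(4) T by (auto simp: tab_Cons col_less_def)
  finally have "length (first_row (add_entry m k rs)) \<le> length r" .
  then have "col_less r (first_row (add_entry m k rs))"
    using 3(2,3) by (auto simp: first_row_add_entry tab_Cons col_less_def nth_append less_Suc_eq
      split: if_splits)
  then show ?case using 3 T by (auto simp: tab_Cons)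
qed

text \<open>The greatest entry has nothing to its right and nothing under it, so it occupies a
  corner.\<close>

lemma remove_greatest:
  assumes "tab Q" "distinct (concat Q)" "m \<in> set (concat Q)" "\<forall>v \<in> set (concat Q). v \<le> m"
  shows "\<exists>k Q'. Q = add_entry m k Q' \<and> k \<le> length Q' \<and> tab Q' \<and> corner k Q
    \<and> m \<notin> set (concat Q')"
  using assms
proof (induction Q)
  case (Cons r rs)
  then have r: "r \<noteq> []" "sorted_wrt (<) r" "col_less r (first_row rs)" "tab rs" "distinct r"
    by (auto simp: tab_Cons)
  show ?case
  proof (cases "m \<in> set r")
    case True
    then obtain a b where ab: "r = a @ m # b" by (auto simp: in_set_conv_decomp)
    then have "b = []" using r(2) Cons.prems(4)
      by (cases b) (auto simp: sorted_wrt_append not_less[symmetric])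
    then have rm: "r = a @ [m]" using ab by simp
    \<comment> \<open>An entry of the next row in the column of \<open>m\<close> would exceed
      \<open>m\<close>.\<close>
    have len: "length (first_row rs) < length r"
    proof (rule ccontr)
      assume "\<not> ?thesis"
      then have "length a < length (first_row rs)" using rm by simp
      then have "m < first_row rs ! length a" "first_row rs ! length a \<in> set (concat rs)"
        using r(3) rm set_first_row[of rs] unfolding col_less_def by (auto dest: nth_mem)
      then show False using Cons.prems(4) by (fastforce simp: not_less[symmetric])
    qed
    then have c: "corner 0 (r # rs)" by (cases rs) (auto simp: corner_def)
    show ?thesis
    proof (cases "a = []")
      case True
      then have "rs = []" using len r(4) rm by (cases rs) (auto simp: tab_Cons)
      then show ?thesis using c True rm by (intro exI[of _ 0] exI[of _ "[]"]) auto
    next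
      case False
      have "col_less a (first_row rs)"
        using r(3) len rm by (auto simp: col_less_def nth_append)
      then show ?thesis
        using c False rm r Cons.prems(2)
        by (intro exI[of _ 0] exI[of _ "a # rs"]) (auto simp: tab_Cons sorted_wrt_append)
    qed
  next
    case False
    then obtain k Q' where Q': "rs = add_entry m k Q'" "k \<le> length Q'" "tab Q'" "corner k rs"
      "m \<notin> set (concat Q')"
      using Cons r by auto
    have "col_less r (first_row Q')"
      using r(3) Q'(1) by (auto simp: first_row_add_entry col_less_def nth_append split: if_splits)
    then show ?thesis
      using Q' r False
      by (intro exI[of _ "Suc k"] exI[of _ "r # Q'"]) (auto simp: tab_Cons corner_def)
  qed
qed simp

section \<open>The recording tableau and the bijection for words\<close>

lemma shape_Q_tableau: "map length (Q_tableau u) = map length (P_tableau u)"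
  by (induction u) (simp_all add: shape_add_entry shape_insert)

text \<open>Labels are added in increasing order; that the shape stays admissible is read off
  \<open>P_tableau\<close>.\<close>

lemma standard_Q_tableau: "distinct u \<Longrightarrow> standard {1..length u} (Q_tableau u)"
proof (induction u)
  case (Cons x u)
  then have IH: "standard {1..length u} (Q_tableau u)" by simp
  have "tab (Q_tableau (x # u))"
    unfolding Q_tableau.simps
  proof (rule tab_add_entry)
    show "tab (P_tableau (x # u))"
      using standard_P_tableau[OF Cons.prems] by (simp only: standard_def)
    show "map length (add_entry (Suc (length u)) (insert_row x (P_tableau u)) (Q_tableau u))
      = map length (P_tableau (x # u))"
      using shape_Q_tableau[of "x # u"] by simp
  qed (use IH in \<open>auto simp: standard_def\<close>)
  moreover have "Suc (length u) \<notin> set (concat (Q_tableau u))"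
    using IH by (simp only: standard_def) simp
  moreover have "{1..Suc (length u)} = insert (Suc (length u)) {1..length u}" by auto
  ultimately show ?case
    using IH
    by (simp only: standard_def Q_tableau.simps length_Cons set_add_entry distinct_add_entry simp_thms)
qed (simp add: standard_def)

lemma length_Q_tableau: "length (Q_tableau u) = length (P_tableau u)"
  using arg_cong[OF shape_Q_tableau, of length u] by simp

text \<open>Turns the row of the newest label into the row of the new cell, for comparison by
  \<open>insert_row_less_iff\<close> and for undoing the last insertion.\<close>

lemma row_of_last_recorded:
  assumes "distinct (x # u)"
  shows "row_of (Suc (length u)) (Q_tableau (x # u)) = insert_row x (P_tableau u)"
  unfolding Q_tableau.simps
proof (rule row_of_added)
  show "Suc (length u) \<notin> set (concat (Q_tableau u))"
    using standard_Q_tableau[of u] assms by (simp only: standard_def) simp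
  show "insert_row x (P_tableau u) \<le> length (Q_tableau u)"
    using insert_row_le length_Q_tableau by simp
qed

text \<open>As \<open>u\<close> is the reversed word, \<open>u ! (length u - i)\<close> is letter
  number \<open>i\<close>, counted from 1. Labels \<open>i\<close> and \<open>i + 1\<close> mark the
  new cells of consecutive insertions, which \<open>insert_row_less_iff\<close> compares.\<close>

lemma row_of_Q_tableau:
  assumes "distinct u" "1 \<le> i" "i < length u"
  shows "row_of i (Q_tableau u) < row_of (Suc i) (Q_tableau u)
    \<longleftrightarrow> u ! (length u - i) > u ! (length u - Suc i)"
  using assms
proof (induction u)
  case (Cons x u)
  have Q: "set (concat (Q_tableau u)) = {1..length u}"
    using standard_Q_tableau[of u] Cons.prems(1) by (simp add: standard_def)
  have old: "row_of j (Q_tableau (x # u)) = row_of j (Q_tableau u)" if "1 \<le> j" "j \<le> length u" for j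
    unfolding Q_tableau.simps using that Q by (intro row_of_add_entry) auto
  show ?case
  proof (cases "i = length u")
    case False
    then have "row_of i (Q_tableau u) < row_of (Suc i) (Q_tableau u)
      \<longleftrightarrow> u ! (length u - i) > u ! (length u - Suc i)"
      using Cons by auto
    then show ?thesis using old False Cons.prems
      by (simp add: Suc_diff_le nth_Cons' Suc_diff_Suc del: Q_tableau.simps)
  next
    case True
    then obtain y w where u: "u = y # w" using Cons.prems by (cases u) auto
    have T: "tab (P_tableau w)" "distinct (concat (P_tableau w))"
      "set (concat (P_tableau w)) = set w"
      using standard_P_tableau[of w] Cons.prems(1) u by (auto simp: standard_def)
    have "insert_row y (P_tableau w) < insert_row x (tableau_insert y (P_tableau w)) \<longleftrightarrow> x < y"
      by (rule insert_row_less_iff[OF T(1,2)]) (use T(3) Cons.prems u in auto)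
    moreover have "row_of i (Q_tableau (x # u)) = insert_row y (P_tableau w)"
      using old[of i] row_of_last_recorded[of y w] Cons.prems True u
      by (simp del: Q_tableau.simps)
    moreover have "row_of (Suc i) (Q_tableau (x # u)) = insert_row x (tableau_insert y (P_tableau w))"
      using row_of_last_recorded[of x u] Cons.prems True u
      by (simp del: Q_tableau.simps)
    ultimately show ?thesis using True u by simp
  qed
qed simp

text \<open>The greatest label of the recording tableau shows the row of the last new cell. Then
  \<open>tableau_insert_inj\<close> recovers the last letter and the previous insertion tableau, and
  \<open>add_entry_inj\<close> the previous recording tableau.\<close>

lemma RSK_inj:
  assumes "distinct u" "distinct u'" "P_tableau u = P_tableau u'" "Q_tableau u = Q_tableau u'"
  shows "u = u'"
proof -
  have "{1..length u} = {1..length u'}"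
    using standard_Q_tableau[OF assms(1)] standard_Q_tableau[OF assms(2)] assms(4)
    by (simp only: standard_def)
  then have "length u = length u'" by (metis card_atLeastAtMost diff_Suc_1)
  then show ?thesis using assms
  proof (induction u u' rule: list_induct2)
    case (Cons x u y u')
    have d: "distinct u" "distinct u'" using Cons.prems by auto
    have ins: "insert_row x (P_tableau u) = insert_row y (P_tableau u')"
      using row_of_last_recorded[OF Cons.prems(1)] row_of_last_recorded[OF Cons.prems(2)]
        Cons.hyps Cons.prems(4) by metis
    have "x = y \<and> P_tableau u = P_tableau u'"
      using standard_P_tableau[OF d(1)] standard_P_tableau[OF d(2)] ins Cons.prems
      by (intro tableau_insert_inj) (auto simp: standard_def)
    moreover have "Q_tableau u = Q_tableau u'"
      by (rule add_entry_inj[where m = "Suc (length u)" and k = "insert_row x (P_tableau u)"])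
        (use standard_Q_tableau[OF d(1)] standard_Q_tableau[OF d(2)] ins Cons
          insert_row_le[of x "P_tableau u"] insert_row_le[of y "P_tableau u'"]
          length_Q_tableau in \<open>auto simp: standard_def tab_def\<close>)
    ultimately show ?case using Cons.IH d by simp
  qed simp
qed

lemma corner_shape: "map length T = map length S \<Longrightarrow> corner k T \<Longrightarrow> corner k S"
  unfolding corner_def by (metis Suc_lessD length_map nth_map)

text \<open>The greatest label of \<open>Q\<close> sits at a corner, also a corner of
  \<open>P\<close>, from which reverse insertion extracts the last letter. \<open>A\<close> is
  arbitrary because the entries left in \<open>P\<close> need not form an initial segment.\<close>

lemma RSK_surj:
  assumes "standard A P" "standard {1..n} Q" "map length P = map length Q"
  shows "\<exists>u. distinct u \<and> length u = n \<and> P_tableau u = P \<and> Q_tableau u = Q"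
  using assms
proof (induction n arbitrary: A P Q)
  case 0
  then have "Q = []" by (cases Q) (auto simp: standard_def tab_Cons)
  then show ?case using 0 by auto
next
  case (Suc n)
  have Q: "tab Q" "distinct (concat Q)" "set (concat Q) = {1..Suc n}"
    using Suc.prems(2) by (simp_all only: standard_def)
  obtain k Q' where Q': "Q = add_entry (Suc n) k Q'" "k \<le> length Q'" "tab Q'" "corner k Q"
      "Suc n \<notin> set (concat Q')"
    using remove_greatest[OF Q(1,2), of "Suc n"] unfolding Q(3) by auto
  have "insert (Suc n) (set (concat Q')) = insert (Suc n) {1..n}"
    using Q(3) Q'(1) set_add_entry[of "Suc n" k Q'] by auto
  then have "set (concat Q') = {1..n}" using Q'(5)
    by (metis atLeastAtMost_iff insert_ident not_less_eq_eq order_refl)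
  then have sQ': "standard {1..n} Q'"
    using Q(2) Q' distinct_add_entry by (simp add: standard_def)
  have P: "tab P" "distinct (concat P)" using Suc.prems(1) by (simp_all only: standard_def)
  obtain x T where T: "tab T" "distinct (concat T)" "x \<notin> set (concat T)"
    "tableau_insert x T = P" "insert_row x T = k"
    using tableau_insert_surj[OF P corner_shape[OF Suc.prems(3)[symmetric] Q'(4)]] by blast
  have "map length T = map length Q'"
  proof (rule add_cell_inj[of k])
    show "add_cell k (map length T) = add_cell k (map length Q')"
      using Suc.prems(3) T(4,5) Q'(1) shape_insert[of x T] shape_add_entry[of "Suc n" k Q'] by simp
  qed (use T Q' insert_row_le[of x T] in \<open>auto simp: tab_def\<close>)
  then obtain u where u: "distinct u" "length u = n" "P_tableau u = T" "Q_tableau u = Q'"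
    using Suc.IH[of "set (concat T)" T Q'] T sQ' by (auto simp: standard_def)
  have "x \<notin> set u" using standard_P_tableau[OF u(1)] u(3) T(3) by (simp only: standard_def) simp
  then show ?case using u T Q' by (intro exI[of _ "x # u"]) simp
qed

section \<open>Transposition\<close>

definition is_cell :: "'a list list \<Rightarrow> nat \<Rightarrow> nat \<Rightarrow> bool" where
  "is_cell T i j \<longleftrightarrow> i < length T \<and> j < length (T ! i)"

text \<open>In coordinates, transposition is an exchange of \<open>i\<close> and \<open>j\<close>.
  The cell asserted in the column clause encodes that row lengths decrease weakly.\<close>

lemma tab_iff_cells:
  "tab T \<longleftrightarrow> [] \<notin> set T
    \<and> (\<forall>i j j'. is_cell T i j' \<longrightarrow> j < j' \<longrightarrow> T ! i ! j < T ! i ! j')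
    \<and> (\<forall>i i' j. is_cell T i' j \<longrightarrow> i < i' \<longrightarrow> is_cell T i j \<and> T ! i ! j < T ! i' ! j)"
  (is "_ \<longleftrightarrow> _ \<and> ?R \<and> ?C")
proof -
  have "(\<forall>r \<in> set T. sorted_wrt (<) r) \<longleftrightarrow> ?R"
    unfolding is_cell_def sorted_wrt_iff_nth_less by (auto simp: all_set_conv_all_nth)
  moreover have "sorted_wrt col_less T \<longleftrightarrow> ?C"
  proof
    assume "sorted_wrt col_less T"
    then show ?C
      unfolding is_cell_def sorted_wrt_iff_nth_less col_less_def
      by (meson less_le_trans less_trans)
  next
    assume C: ?C
    show "sorted_wrt col_less T"
      unfolding sorted_wrt_iff_nth_less col_less_def
    proof (intro allI impI conjI)
      fix i i' assume i: "i < i'" "i' < length T"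
      show "length (T ! i') \<le> length (T ! i)"
      \<comment> \<open>The cell of row \<open>i'\<close> in column \<open>length (T ! i)\<close>
        would force row \<open>i\<close> to have a cell there as well.\<close>
      proof (rule ccontr)
        assume "\<not> ?thesis"
        then show False using C i unfolding is_cell_def by (meson not_le less_irrefl)
      qed
    qed (use C in \<open>auto simp: is_cell_def\<close>)
  qed
  ultimately show ?thesis by (simp add: tab_def)
qed

lemma sorted_lengths: "tab T \<Longrightarrow> sorted (rev (map length T))"
  unfolding tab_def sorted_wrt_rev sorted_wrt_map
  by (auto elim!: sorted_wrt_mono_rel[rotated] simp: col_less_def)

text \<open>Row lengths decrease weakly, so the rows longer than \<open>j\<close> form an initial
  segment. This links the columns built by \<open>List.transpose\<close> to cells.\<close>

lemma less_length_filter: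
  assumes "sorted (rev (map length T))"
  shows "i < length (filter (\<lambda>r. j < length r) T) \<longleftrightarrow> is_cell T i j"
  using assms
proof (induction T arbitrary: i)
  case (Cons r rs)
  show ?case
  proof (cases "j < length r")
    case True
    then show ?thesis using Cons by (cases i) (auto simp: is_cell_def sorted_append)
  next
    case False
    then have "\<forall>s \<in> set (r # rs). \<not> j < length s"
      using Cons.prems by (auto simp: sorted_append)
    then have "filter (\<lambda>r. j < length r) (r # rs) = []" "\<not> is_cell (r # rs) i j"
      using nth_mem[of i "r # rs"] unfolding filter_empty_conv is_cell_def by blast+
    then show ?thesis by simp
  qed
qed (simp add: is_cell_def)

lemma is_cell_transpose:
  assumes "sorted (rev (map length T))"
  shows "is_cell (List.transpose T) j i \<longleftrightarrow> is_cell T i j"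
proof -
  have "is_cell (List.transpose T) j i \<longleftrightarrow> j < length (List.transpose T) \<and> is_cell T i j"
    by (auto simp: is_cell_def[of "List.transpose T"] List.nth_transpose less_length_filter[OF assms])
  moreover have "j < length (List.transpose T)" if "is_cell T i j"
  proof -
    have "0 < length (filter (\<lambda>r. j < length r) T)"
      using that less_length_filter[OF assms] by (metis gr_implies_not0 not_gr0)
    then have "is_cell T 0 j" using less_length_filter[OF assms] by simp
    then show ?thesis by (auto simp: is_cell_def length_transpose_sorted[OF assms])
  qed
  ultimately show ?thesis by blast
qed

lemma nth_transpose_cell:
  assumes "sorted (rev (map length T))" "is_cell T i j"
  shows "List.transpose T ! j ! i = T ! i ! j"
proof (rule nth_nth_transpose_sorted[OF assms(1)])
  show "j < length (List.transpose T)"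
    using is_cell_transpose[OF assms(1)] assms(2) by (auto simp: is_cell_def)
  show "i < length (filter (\<lambda>ys. j < length ys) T)"
    using less_length_filter[OF assms(1)] assms(2) by simp
qed

lemma tab_transpose:
  assumes "tab T" shows "tab (List.transpose T)"
proof -
  note s = sorted_lengths[OF assms]
  have T: "\<And>i j j'. is_cell T i j' \<Longrightarrow> j < j' \<Longrightarrow> T ! i ! j < T ! i ! j'"
    "\<And>i i' j. is_cell T i' j \<Longrightarrow> i < i' \<Longrightarrow> is_cell T i j \<and> T ! i ! j < T ! i' ! j"
    using assms by (auto simp: tab_iff_cells)
  \<comment> \<open>This becomes the cell condition in the column clause for the transpose.\<close>
  have left: "is_cell T i j" if "is_cell T i j'" "j < j'" for i j j'
    using that by (auto simp: is_cell_def)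
  have "[] \<notin> set (List.transpose T)"
  proof
    assume "[] \<in> set (List.transpose T)"
    then obtain j where j: "j < length (List.transpose T)" "List.transpose T ! j = []"
      by (auto simp: in_set_conv_nth)
    then have "is_cell T 0 j"
      by (auto simp: is_cell_def length_transpose_sorted[OF s] split: if_splits)
    then have "is_cell (List.transpose T) j 0" using is_cell_transpose[OF s] by simp
    then show False using j by (simp add: is_cell_def)
  qed
  then show ?thesis
    unfolding tab_iff_cells is_cell_transpose[OF s]
    using T left nth_transpose_cell[OF s] by metis
qed

text \<open>Concluding \<open>i = i'\<close> is enough: within a row, strict increase already
  separates the entries.\<close>

lemma distinct_concat_cells:
  assumes "tab T"
  shows "distinct (concat T) \<longleftrightarrow>
    (\<forall>i j i' j'. is_cell T i j \<longrightarrow> is_cell T i' j' \<longrightarrow> T ! i ! j = T ! i' ! j' \<longrightarrow> i = i')"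
proof -
  have rows: "\<forall>r\<in>set T. distinct r" using assms by (auto simp: tab_def strict_sorted_iff)
  have "distinct (concat T) \<longleftrightarrow> sorted_wrt (\<lambda>r s. set r \<inter> set s = {}) T"
    using rows by (induction T) auto
  also have "\<dots> \<longleftrightarrow> (\<forall>i j i' j'. is_cell T i j \<longrightarrow> is_cell T i' j' \<longrightarrow> T ! i ! j = T ! i' ! j' \<longrightarrow> i = i')"
  proof
    assume d: "sorted_wrt (\<lambda>r s. set r \<inter> set s = {}) T"
    have "\<not> i < i'" if "is_cell T i j" "is_cell T i' j'" "T ! i ! j = T ! i' ! j'" for i j i' j'
    proof
      assume "i < i'"
      then have "set (T ! i) \<inter> set (T ! i') = {}"
        using d that by (simp add: sorted_wrt_iff_nth_less is_cell_def)
      then show False using that unfolding is_cell_def by (metis disjoint_iff nth_mem)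
    qed
    then show "\<forall>i j i' j'. is_cell T i j \<longrightarrow> is_cell T i' j' \<longrightarrow> T ! i ! j = T ! i' ! j' \<longrightarrow> i = i'"
      by (metis nat_neq_iff)
  next
    assume c: "\<forall>i j i' j'. is_cell T i j \<longrightarrow> is_cell T i' j' \<longrightarrow> T ! i ! j = T ! i' ! j' \<longrightarrow> i = i'"
    show "sorted_wrt (\<lambda>r s. set r \<inter> set s = {}) T"
      unfolding sorted_wrt_iff_nth_less
    proof (intro allI impI)
      fix i i' assume i: "i < i'" "i' < length T"
      show "set (T ! i) \<inter> set (T ! i') = {}"
      proof (rule equals0I)
        fix v assume "v \<in> set (T ! i) \<inter> set (T ! i')"
        then obtain j j' where "is_cell T i j" "T ! i ! j = v" "is_cell T i' j'" "T ! i' ! j' = v"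
          using i by (auto simp: is_cell_def in_set_conv_nth)
        then have "i = i'" using c by blast
        then show False using i by simp
      qed
    qed
  qed
  finally show ?thesis .
qed

lemma set_concat_cells: "v \<in> set (concat T) \<longleftrightarrow> (\<exists>i j. is_cell T i j \<and> T ! i ! j = v)"
proof
  assume "v \<in> set (concat T)"
  then obtain r where "r \<in> set T" "v \<in> set r" by auto
  then show "\<exists>i j. is_cell T i j \<and> T ! i ! j = v" by (metis in_set_conv_nth is_cell_def)
qed (auto simp: is_cell_def intro!: bexI[OF _ nth_mem])

lemma standard_transpose:
  assumes "standard A T" shows "standard A (List.transpose T)"
proof -
  have T: "tab T" "distinct (concat T)" "set (concat T) = A"
    using assms by (simp_all only: standard_def)
  note s = sorted_lengths[OF T(1)]
  \<comment> \<open>Columns of \<open>T\<close> are the rows of the transpose, so equal entries must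
    be shown to share their column.\<close>
  have rows: "j = j'" if "is_cell T i j" "is_cell T i' j'" "T ! i ! j = T ! i' ! j'" for i j i' j'
  proof -
    have "i = i'" using that T(1,2) by (auto simp: distinct_concat_cells)
    moreover have "distinct (T ! i)"
      using that(1) T(1) by (auto simp: tab_def strict_sorted_iff is_cell_def)
    ultimately show ?thesis using that by (auto simp: is_cell_def nth_eq_iff_index_eq)
  qed
  have "distinct (concat (List.transpose T))"
    unfolding distinct_concat_cells[OF tab_transpose[OF T(1)]] is_cell_transpose[OF s]
    using rows nth_transpose_cell[OF s] by metis
  moreover have "set (concat (List.transpose T)) = A"
    unfolding T(3)[symmetric] set_eq_iff set_concat_cells is_cell_transpose[OF s]
    using nth_transpose_cell[OF s] by metis
  ultimately show ?thesis using tab_transpose[OF T(1)] by (simp only: standard_def)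
qed

lemma row_of_cell: "distinct (concat T) \<Longrightarrow> is_cell T i j \<Longrightarrow> row_of (T ! i ! j) T = i"
proof (induction T arbitrary: i)
  case (Cons r rs)
  show ?case
  proof (cases i)
    case (Suc i')
    then have c: "is_cell rs i' j" using Cons.prems by (simp add: is_cell_def)
    then have "rs ! i' ! j \<in> set (concat rs)"
      unfolding set_concat_cells by blast
    then have "rs ! i' ! j \<notin> set r" using Cons.prems by auto
    then show ?thesis using Cons c Suc by simp
  qed (use Cons in \<open>simp add: is_cell_def\<close>)
qed (simp add: is_cell_def)

text \<open>If \<open>v\<close> is at \<open>(i, j)\<close> and \<open>Suc v\<close> at
  \<open>(i', j')\<close>, exactly one of \<open>i < i'\<close> and \<open>j < j'\<close>
  holds.\<close>

lemma row_of_transpose: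
  assumes "standard A T" "v \<in> A" "Suc v \<in> A"
  shows "row_of v (List.transpose T) < row_of (Suc v) (List.transpose T)
    \<longleftrightarrow> \<not> row_of v T < row_of (Suc v) T"
proof -
  have T: "tab T" "distinct (concat T)" "set (concat T) = A"
    using assms(1) by (simp_all only: standard_def)
  note s = sorted_lengths[OF T(1)]
  have T': "distinct (concat (List.transpose T))"
    using standard_transpose[OF assms(1)] by (simp only: standard_def)
  obtain i j where ij: "is_cell T i j" "T ! i ! j = v"
    using assms(2) set_concat_cells T(3) by metis
  obtain i' j' where ij': "is_cell T i' j'" "T ! i' ! j' = Suc v"
    using assms(3) set_concat_cells T(3) by metis
  have R: "\<And>i j j'. is_cell T i j' \<Longrightarrow> j < j' \<Longrightarrow> T ! i ! j < T ! i ! j'"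
    and C: "\<And>i i' j. is_cell T i' j \<Longrightarrow> i < i' \<Longrightarrow> is_cell T i j \<and> T ! i ! j < T ! i' ! j"
    using T(1) by (auto simp: tab_iff_cells)
  have r: "row_of v T = i" "row_of (Suc v) T = i'"
    using row_of_cell[OF T(2)] ij ij' by metis+
  have c: "row_of v (List.transpose T) = j" "row_of (Suc v) (List.transpose T) = j'"
    using row_of_cell[OF T', of j i] row_of_cell[OF T', of j' i'] nth_transpose_cell[OF s]
      is_cell_transpose[OF s] ij ij' by metis+
  \<comment> \<open>Otherwise cell \<open>(i, j')\<close> would hold a number strictly between
    \<open>v\<close> and \<open>Suc v\<close>.\<close>
  have "\<not> (i < i' \<and> j < j')"
  proof
    assume "i < i' \<and> j < j'"
    then have "T ! i ! j < T ! i ! j'" "T ! i ! j' < T ! i' ! j'"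
      using C[OF ij'(1)] R by auto
    then show False using ij(2) ij'(2) by simp
  qed
  \<comment> \<open>Going up from \<open>v\<close> and then left cannot reach a larger
    entry.\<close>
  moreover have "\<not> (i' \<le> i \<and> j' \<le> j)"
  proof
    assume a: "i' \<le> i \<and> j' \<le> j"
    have "is_cell T i' j" "T ! i' ! j \<le> T ! i ! j"
      using C[OF ij(1), of i'] a ij(1) by (cases "i' = i"; auto)+
    moreover have "T ! i' ! j' \<le> T ! i' ! j"
      using R[of i' j j'] a calculation(1) by (cases "j' = j") auto
    ultimately show False using ij(2) ij'(2) by simp
  qed
  ultimately show ?thesis unfolding r c by auto
qed

section \<open>Conjugate shapes and major indices of tableaux\<close>

lemma shape_transpose:
  assumes "sorted (rev (map length T))"
  shows "map length (List.transpose T) = conjugate (map length T)"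
proof (cases T)
  case (Cons r rs)
  have "length (List.transpose T) = length r"
    using length_transpose_sorted[OF assms] Cons by simp
  then show ?thesis
    using Cons by (intro nth_equalityI) (simp_all add: List.nth_transpose filter_map o_def)
qed simp

text \<open>\<open>List.transpose_transpose\<close> keeps the rows before the first empty one, and a
  tableau has no empty row.\<close>

lemma transpose_involution: "tab T \<Longrightarrow> List.transpose (List.transpose T) = T"
  using List.transpose_transpose[OF sorted_lengths] by (auto simp: tab_def takeWhile_eq_all_conv)

lemma conjugate_involution:
  assumes "sorted_wrt (\<ge>) s" "0 \<notin> set s"
  shows "conjugate (conjugate s) = s"
proof -
  \<comment> \<open>Dummy rows of the given lengths turn conjugation into transposition; since no
    part is 0, no row is empty.\<close>
  define T where "T = map (\<lambda>k. replicate k ()) s"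
  have len: "map length T = s" by (simp add: T_def o_def)
  have sT: "sorted (rev (map length T))" using assms(1) by (simp add: len sorted_wrt_rev)
  have "List.transpose (List.transpose T) = T"
    unfolding List.transpose_transpose[OF sT] using assms(2) by (simp add: T_def takeWhile_eq_all_conv) (metis not_gr0)
  moreover have "map length (List.transpose T) = conjugate s"
    using shape_transpose[OF sT] len by simp
  moreover have "sorted (rev (map length (List.transpose T)))"
    using sorted_transpose by blast
  ultimately show ?thesis using shape_transpose len by metis
qed

definition tableau_maj :: "nat \<Rightarrow> nat list list \<Rightarrow> nat" where
  "tableau_maj n T = (\<Sum>i | 1 \<le> i \<and> i \<le> n - 1 \<and> row_of i T < row_of (i + 1) T. i)"

lemma tableau_maj_transpose:
  assumes "standard {1..n} T"
  shows "tableau_maj n (List.transpose T) + tableau_maj n T = \<Sum>{1..n - 1}"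
proof -
  let ?D = "{i. 1 \<le> i \<and> i \<le> n - 1 \<and> row_of i T < row_of (i + 1) T}"
  have D: "{i. 1 \<le> i \<and> i \<le> n - 1 \<and> row_of i (List.transpose T) < row_of (i + 1) (List.transpose T)}
    = {1..n - 1} - ?D"
    using row_of_transpose[OF assms] by auto
  have "?D \<subseteq> {1..n - 1}" by auto
  then show ?thesis
    unfolding tableau_maj_def D by (rule sum.subset_diff[OF _ finite_atLeastAtMost, symmetric])
qed

section \<open>Permutations\<close>

definition rev_word :: "nat \<Rightarrow> (nat \<Rightarrow> nat) \<Rightarrow> nat list" where
  "rev_word n p = rev (map p [1..<n + 1])"

lemma length_rev_word [simp]: "length (rev_word n p) = n"
  by (simp add: rev_word_def)

lemma nth_rev_word: "a < n \<Longrightarrow> rev_word n p ! a = p (n - a)"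
  by (simp add: rev_word_def rev_nth Suc_diff_Suc del: upt_Suc)

lemma rev_word_permutes:
  assumes "p permutes {1..n}"
  shows "distinct (rev_word n p)" "set (rev_word n p) = {1..n}"
proof -
  show "distinct (rev_word n p)"
    using permutes_inj_on[OF assms] by (simp add: rev_word_def distinct_map del: upt_Suc)
  have "set (rev_word n p) = p ` {1..n}"
    unfolding rev_word_def set_rev set_map set_upt by (rule arg_cong) auto
  then show "set (rev_word n p) = {1..n}" using permutes_image[OF assms] by simp
qed

lemma insertion_tableau_eq: "insertion_tableau n p = P_tableau (rev_word n p)"
  by (simp add: insertion_tableau_def rev_word_def foldr_conv_fold del: upt_Suc)

lemma maj_eq_tableau_maj:
  assumes "p permutes {1..n}"
  shows "maj n p = tableau_maj n (Q_tableau (rev_word n p))"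
  unfolding maj_def tableau_maj_def
proof (rule sum.cong[OF Collect_cong])
  fix i
  show "1 \<le> i \<and> i \<le> n - 1 \<and> p (i + 1) < p i \<longleftrightarrow> 1 \<le> i \<and> i \<le> n - 1 \<and>
    row_of i (Q_tableau (rev_word n p)) < row_of (i + 1) (Q_tableau (rev_word n p))"
  proof (cases "1 \<le> i \<and> i \<le> n - 1")
    case True
    then have "rev_word n p ! (n - i) = p i" "rev_word n p ! (n - Suc i) = p (Suc i)"
      by (auto simp: nth_rev_word)
    then show ?thesis using True row_of_Q_tableau[OF rev_word_permutes(1)[OF assms], of i] by auto
  qed auto
qed simp

lemma maj_inv_eq_tableau_maj:
  assumes "p permutes {1..n}"
  shows "maj n (inv p) = tableau_maj n (P_tableau (rev_word n p))"
  unfolding maj_def tableau_maj_def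
proof (rule sum.cong[OF Collect_cong])
  fix v
  show "1 \<le> v \<and> v \<le> n - 1 \<and> inv p (v + 1) < inv p v \<longleftrightarrow> 1 \<le> v \<and> v \<le> n - 1 \<and>
    row_of v (P_tableau (rev_word n p)) < row_of (v + 1) (P_tableau (rev_word n p))"
  proof (cases "1 \<le> v \<and> v \<le> n - 1")
    case True
    have inv: "inv p w \<in> {1..n} \<and> p (inv p w) = w" if "w \<in> {1..n}" for w
      using that permutes_in_image[OF permutes_inv[OF assms]] permutes_inverses(1)[OF assms] by auto
    have v: "inv p v \<in> {1..n}" "p (inv p v) = v" "inv p (Suc v) \<in> {1..n}"
      "p (inv p (Suc v)) = Suc v"
      using inv[of v] inv[of "Suc v"] True by auto
    \<comment> \<open>The value \<open>v\<close> is at position \<open>inv p v\<close> of the word,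
      hence at index \<open>n - inv p v\<close> of its reversal.\<close>
    then have "row_of v (P_tableau (rev_word n p)) < row_of (Suc v) (P_tableau (rev_word n p))
      \<longleftrightarrow> n - inv p v < n - inv p (Suc v)"
      by (intro row_of_P_tableau[OF rev_word_permutes(1)[OF assms]]) (auto simp: nth_rev_word)
    then show ?thesis using True v by auto
  qed auto
qed simp

section \<open>Transposition of pairs of tableaux carried over to permutations\<close>

definition tableau_pairs :: "nat \<Rightarrow> (nat list list \<times> nat list list) set" where
  "tableau_pairs n =
    {(P, Q). standard {1..n} P \<and> standard {1..n} Q \<and> map length P = map length Q}"

definition RSK :: "nat \<Rightarrow> (nat \<Rightarrow> nat) \<Rightarrow> nat list list \<times> nat list list" where
  "RSK n p = (P_tableau (rev_word n p), Q_tableau (rev_word n p))"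

lemma bij_RSK: "bij_betw (RSK n) {p. p permutes {1..n}} (tableau_pairs n)"
  unfolding bij_betw_def
proof
  show "inj_on (RSK n) {p. p permutes {1..n}}"
  proof (rule inj_onI)
    fix p p' assume p: "p \<in> {p. p permutes {1..n}}" "p' \<in> {p. p permutes {1..n}}" "RSK n p = RSK n p'"
    have eq: "rev_word n p = rev_word n p'"
      by (rule RSK_inj) (use p rev_word_permutes in \<open>auto simp: RSK_def\<close>)
    show "p = p'"
    proof
      fix i
      show "p i = p' i"
      proof (cases "i \<in> {1..n}")
        case True
        then show ?thesis
          using nth_rev_word[of "n - i" n p] nth_rev_word[of "n - i" n p'] eq by auto
      next
        case False
        then show ?thesis using p permutes_not_in by (metis mem_Collect_eq)
      qed
    qed
  qed
  show "RSK n ` {p. p permutes {1..n}} = tableau_pairs n"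
  proof (intro equalityI subsetI)
    fix x assume "x \<in> RSK n ` {p. p permutes {1..n}}"
    then obtain p where p: "p permutes {1..n}" "x = RSK n p" by auto
    then show "x \<in> tableau_pairs n"
      using standard_P_tableau[OF rev_word_permutes(1)[OF p(1)]]
        standard_Q_tableau[OF rev_word_permutes(1)[OF p(1)]] shape_Q_tableau
        rev_word_permutes(2)[OF p(1)]
      by (simp add: tableau_pairs_def RSK_def)
  next
    fix x assume "x \<in> tableau_pairs n"
    then obtain P Q where x: "x = (P, Q)" "standard {1..n} P" "standard {1..n} Q"
      "map length P = map length Q" by (auto simp: tableau_pairs_def)
    then obtain u where u: "distinct u" "length u = n" "P_tableau u = P" "Q_tableau u = Q"
      using RSK_surj by blast
    have set_u: "set u = {1..n}"
      using standard_P_tableau[OF u(1)] u(3) x(2) by (simp only: standard_def)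
    \<comment> \<open>Undoes the reversal of the word; outside \<open>{1..n}\<close> the identity is
      forced by \<open>permutes\<close>.\<close>
    define p where "p i = (if i \<in> {1..n} then u ! (n - i) else i)" for i
    have "inj_on p {1..n}"
      using u(1,2) by (auto simp: inj_on_def p_def nth_eq_iff_index_eq)
    moreover have "u ! (n - i) \<in> {1..n}" if "i \<in> {1..n}" for i
      using nth_mem[of "n - i" u] that u(2) unfolding set_u by simp
    then have "p ` {1..n} \<subseteq> {1..n}" by (auto simp: p_def)
    ultimately have "bij_betw p {1..n} {1..n}"
      by (simp add: bij_betw_def endo_inj_surj)
    then have p: "p permutes {1..n}" by (rule bij_imp_permutes) (auto simp: p_def)
    have "rev_word n p = u"
      by (rule nth_equalityI) (use u(2) in \<open>auto simp: nth_rev_word p_def\<close>)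
    then show "x \<in> RSK n ` {p. p permutes {1..n}}"
      using p u x(1) by (auto simp: RSK_def)
  qed
qed

text \<open>The map is its own inverse, so the two inverse laws coincide, and so do the two
  inclusions.\<close>

lemma bij_transpose_pairs: "bij_betw (map_prod List.transpose List.transpose) (tableau_pairs n) (tableau_pairs n)"
proof (rule bij_betw_byWitness[where f' = "map_prod List.transpose List.transpose"])
  have t: "standard {1..n} T \<Longrightarrow> List.transpose (List.transpose T) = T" for T :: "nat list list"
    using transpose_involution by (simp add: standard_def)
  then show "\<forall>x\<in>tableau_pairs n. map_prod List.transpose List.transpose (map_prod List.transpose List.transpose x) = x"
    "\<forall>x\<in>tableau_pairs n. map_prod List.transpose List.transpose (map_prod List.transpose List.transpose x) = x"
    by (auto simp: tableau_pairs_def)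
  have shape: "map length (List.transpose T) = conjugate (map length T)"
    if "standard {1..n} T" for T
    using that by (simp add: standard_def shape_transpose sorted_lengths)
  show "map_prod List.transpose List.transpose ` tableau_pairs n \<subseteq> tableau_pairs n"
    "map_prod List.transpose List.transpose ` tableau_pairs n \<subseteq> tableau_pairs n"
    by (auto simp: tableau_pairs_def standard_transpose shape)
qed

lemma transposing_bijection:
  "\<exists>f. bij_betw f {p. p permutes {1..n}} {p. p permutes {1..n}} \<and>
    (\<forall>p. p permutes {1..n} \<longrightarrow> RSK_shape n (f p) = conjugate (RSK_shape n p)
      \<and> maj n (f p) + maj n p = \<Sum>{1..n - 1}
      \<and> maj n (inv (f p)) + maj n (inv p) = \<Sum>{1..n - 1})"
proof -
  let ?S = "{p. p permutes {1..n}}"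
  define f where "f = inv_into ?S (RSK n) \<circ> (map_prod List.transpose List.transpose \<circ> RSK n)"
  have bij: "bij_betw f ?S ?S"
    unfolding f_def
    by (rule bij_betw_trans[OF bij_betw_trans[OF bij_RSK bij_transpose_pairs]
      bij_betw_inv_into[OF bij_RSK]])
  have facts: "RSK_shape n (f p) = conjugate (RSK_shape n p) \<and> maj n (f p) + maj n p = \<Sum>{1..n - 1}
    \<and> maj n (inv (f p)) + maj n (inv p) = \<Sum>{1..n - 1}" if p: "p permutes {1..n}" for p
  proof -
    have fp: "f p permutes {1..n}" using bij p bij_betwE by blast
    have RSKp: "RSK n p \<in> tableau_pairs n" using bij_betwE[OF bij_RSK] p by blast
    then have "map_prod List.transpose List.transpose (RSK n p) \<in> tableau_pairs n"
      using bij_betwE[OF bij_transpose_pairs] by blast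
    then have "RSK n (f p) = map_prod List.transpose List.transpose (RSK n p)"
      using bij_betw_inv_into_right[OF bij_RSK] by (simp add: f_def)
    then have PQ: "P_tableau (rev_word n (f p)) = List.transpose (P_tableau (rev_word n p))"
      "Q_tableau (rev_word n (f p)) = List.transpose (Q_tableau (rev_word n p))"
      by (simp_all add: RSK_def)
    have std: "standard {1..n} (P_tableau (rev_word n p))" "standard {1..n} (Q_tableau (rev_word n p))"
      using RSKp by (simp_all add: RSK_def tableau_pairs_def)
    have "RSK_shape n (f p) = conjugate (RSK_shape n p)"
      unfolding RSK_shape_def insertion_tableau_eq PQ
      using std(1) by (intro shape_transpose sorted_lengths) (simp add: standard_def)
    then show ?thesis
      unfolding maj_eq_tableau_maj[OF p] maj_eq_tableau_maj[OF fp]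
        maj_inv_eq_tableau_maj[OF p] maj_inv_eq_tableau_maj[OF fp] PQ
      using tableau_maj_transpose[OF std(1)] tableau_maj_transpose[OF std(2)] by simp
  qed
  show ?thesis using bij facts by blast
qed

section \<open>Shapes as partitions and the measure as a finite sum\<close>

lemma RSK_shape_partition:
  assumes "p permutes {1..n}"
  shows "sorted_wrt (\<ge>) (RSK_shape n p)" "0 \<notin> set (RSK_shape n p)"
proof -
  have "tab (P_tableau (rev_word n p))"
    using standard_P_tableau[OF rev_word_permutes(1)[OF assms]] by (simp add: standard_def)
  then show "sorted_wrt (\<ge>) (RSK_shape n p)" "0 \<notin> set (RSK_shape n p)"
    using sorted_lengths
    by (auto simp: RSK_shape_def insertion_tableau_eq sorted_wrt_rev tab_def)
qed

lemma pmf_RSK_measure: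
  assumes "t > 0"
  shows "pmf (RSK_measure n t) mu =
    (\<Sum>p | p permutes {1..n} \<and> conjugate (RSK_shape n p) = mu. pmf (perm_pmf n t) p)"
proof -
  let ?A = "{p. p permutes {1..n} \<and> conjugate (RSK_shape n p) = mu}"
  have fin: "finite ?A"
    by (rule finite_subset[OF _ finite_permutations[of "{1..n}"]]) auto
  have supp: "set_pmf (perm_pmf n t) \<subseteq> {p. p permutes {1..n}}"
    using pmf_perm_pmf[OF assms] by (auto simp: set_pmf_iff split: if_splits)
  have "pmf (RSK_measure n t) mu
    = measure (perm_pmf n t) ((\<lambda>p. conjugate (RSK_shape n p)) -` {mu})"
    by (simp add: RSK_measure_def pmf_map)
  \<comment> \<open>The preimage may contain functions that are not permutations, but these carry no
    mass.\<close>
  also have "\<dots> = measure (perm_pmf n t) ?A"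
    by (rule measure_prob_cong_0) (use supp in \<open>auto simp: set_pmf_iff\<close>)
  also have "\<dots> = (\<Sum>p\<in>?A. pmf (perm_pmf n t) p)"
    by (rule measure_measure_pmf_finite[OF fin])
  finally show ?thesis .
qed

theorem theorem5:
  fixes q :: real and n :: nat and lam :: "nat list"
  assumes "q \<ge> 2" and "n \<ge> 1" and "partition_of n lam"
  shows "pmf (RSK_measure n q) lam = pmf (RSK_measure n (1 / q)) (conjugate lam)"
proof -
  let ?S = "{p. p permutes {1..n}}"
  have q: "q > 0" "1 / q > 0" using assms(1) by auto
  obtain f where f: "bij_betw f ?S ?S"
    and facts: "\<forall>p. p permutes {1..n} \<longrightarrow> RSK_shape n (f p) = conjugate (RSK_shape n p)
      \<and> maj n (f p) + maj n p = \<Sum>{1..n - 1}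
      \<and> maj n (inv (f p)) + maj n (inv p) = \<Sum>{1..n - 1}"
    using transposing_bijection by blast
  \<comment> \<open>Adding the two complement identities in \<open>facts\<close>, the weight
    exponents of \<open>p\<close> and \<open>f p\<close> sum to this exponent of
    \<open>q\<close>.\<close>
  define c where "c = q ^ (2 * \<Sum>{1..n - 1})"
  have c: "c \<noteq> 0" using q by (simp add: c_def)
  have fS: "f p permutes {1..n}" if "p permutes {1..n}" for p
    using bij_betwE[OF f] that by blast
  have weight: "perm_weight n (1 / q) (f p) = perm_weight n q p / c" if p: "p permutes {1..n}" for p
  proof -
    have "2 * \<Sum>{1..n - 1} = (maj n (f p) + maj n (inv (f p))) + (maj n p + maj n (inv p))"
      using facts[rule_format, OF p] by linarith
    then show ?thesis
      using q by (simp add: perm_weight_def c_def power_add power_one_over field_simps)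
  qed
  \<comment> \<open>The normalising sums differ by the same factor \<open>c\<close> as the weights,
    so it cancels in the probabilities.\<close>
  have "(\<Sum>s\<in>?S. perm_weight n (1 / q) s) = (\<Sum>s\<in>?S. perm_weight n (1 / q) (f s))"
    by (rule sum.reindex_bij_betw[OF f, symmetric])
  also have "\<dots> = (\<Sum>s\<in>?S. perm_weight n q s) / c"
    unfolding sum_divide_distrib by (rule sum.cong) (use weight in auto)
  finally have prob: "pmf (perm_pmf n (1 / q)) (f p) = pmf (perm_pmf n q) p"
    if "p permutes {1..n}" for p
    using that fS[OF that] weight[OF that] c
    by (simp add: pmf_perm_pmf[OF q(1)] pmf_perm_pmf[OF q(2)] del: sum_divide_distrib)
  \<comment> \<open>The shape of \<open>f p\<close> is already conjugated, so the left side says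
    \<open>RSK_shape n p = conjugate lam\<close>; conjugation is an involution on both
    partitions.\<close>
  have shape: "conjugate (RSK_shape n (f p)) = conjugate lam \<longleftrightarrow> conjugate (RSK_shape n p) = lam"
    if p: "p permutes {1..n}" for p
    using conjugate_involution[OF RSK_shape_partition[OF p]] facts p
      conjugate_involution[of lam] assms(3) unfolding partition_of_def by metis
  have "bij_betw f {p \<in> ?S. conjugate (RSK_shape n p) = lam}
    {p \<in> ?S. conjugate (RSK_shape n p) = conjugate lam}"
    unfolding bij_betw_def
  proof
    show "inj_on f {p \<in> ?S. conjugate (RSK_shape n p) = lam}"
      using f by (auto simp: bij_betw_def intro: inj_on_subset)
    show "f ` {p \<in> ?S. conjugate (RSK_shape n p) = lam}
      = {p \<in> ?S. conjugate (RSK_shape n p) = conjugate lam}"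
    proof (intro equalityI subsetI)
      fix x assume x: "x \<in> {p \<in> ?S. conjugate (RSK_shape n p) = conjugate lam}"
      then obtain p where "p \<in> ?S" "x = f p" using f by (auto simp: bij_betw_def)
      then show "x \<in> f ` {p \<in> ?S. conjugate (RSK_shape n p) = lam}" using x shape by auto
    qed (use fS shape in auto)
  qed
  from sum.reindex_bij_betw[OF this, of "pmf (perm_pmf n (1 / q))"]
  have "pmf (RSK_measure n (1 / q)) (conjugate lam)
    = (\<Sum>p\<in>{p \<in> ?S. conjugate (RSK_shape n p) = lam}. pmf (perm_pmf n (1 / q)) (f p))"
    by (simp add: pmf_RSK_measure[OF q(2)])
  also have "\<dots> = pmf (RSK_measure n q) lam"
    unfolding pmf_RSK_measure[OF q(1)] by (rule sum.cong) (use prob in auto)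
  finally show ?thesis by simp
qed

end
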